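(* Let $f=\sum_{i=1}^m f_i$ with $f_i:\mathbb{R}^d\to\mathbb{R}$. Assume that: (i) each $f_i$ is convex and has $L$-Lipschitz continuous gradient, i.e. $f_i(x)+\langle\nabla f_i(x),y-x\rangle\le f_i(y)\le f_i(x)+\langle\nabla f_i(x),y-x\rangle+\frac L2\|y-x\|^2$ for all $x,y\in\mathbb{R}^d$; (ii) $f_i(x)=\ell(a_i^Tx,b_i)$ with $a_i\in\mathbb{R}^d$, $b_i\in\mathbb{R}$, and $\mathrm{supp}(\nabla f_i(x))=\mathrm{supp}(a_i)$ for every $x$ and $i$; (iii) there is a scalar $C$ with $\|\nabla f_i(x)\|\le C$ for all $i$ and all $x\in\mathbb{R}^d$. Let $\Delta=\min(\Delta_{\rm ave},\Delta_{\max})$, $\bar L=L\sqrt{m(1+\Delta)}$ and $\sigma=\min\big(\sqrt{m(1+\Delta_{\rm ave})},1+\Delta_{\max}\big)$. Let $Q$ be an unbiased random quantizer with $\mathbf{E}\|Q(v)-v\|^2\le\beta\|v\|^2$ for all $v$. Let $\tau_k^i\le\tau$ for all $i,k$, and suppose that the positive step size satisfies $$\gamma<\frac{1}{1+\sqrt{1+8\tau(\tau+1)}}\cdot\frac2{\bar L}.$$ Then the iterates generated by $$x_{k+1}=x_k-\gamma\sum_{i=1}^mQ\big(\nabla f_i(x_{k-\tau_k^i})\big)$$ satisfy, for every $K\in\mathbb{N}$, $$\min_{k\in[0,K]}\mathbf{E}\|\nabla f(x_k)\|^2\le\frac2\gamma\,\frac1{K+1}\big(f(x_0)-f^\star\big)+e,\qquad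 e=2\beta\sigma mC^2.$$
   Context: $\|\cdot\|$ is the Euclidean norm, $\mathrm{supp}(x)=\{i: x^i\ne0\}$, and $[0,K]=\{0,1,\dots,K\}$. $f^\star$ is the minimum value of $f$ (assumed attained). $x_0\in\mathbb{R}^d$ is a deterministic initial point. The delays $\tau_k^i$ are nonnegative integers, $\tau$ is a nonnegative integer, and $x_k:=x_0$ for $k<0$. Conflict graph degrees: $\Delta_{\rm ave}=\frac1m\sum_{i=1}^m\sum_{j\ne i}\mathbf 1\{\mathrm{supp}(a_i)\cap\mathrm{supp}(a_j)\ne\emptyset\}$ and $\Delta_{\max}=\max_{i}\sum_{j\ne i}\mathbf 1\{\mathrm{supp}(a_i)\cap\mathrm{supp}(a_j)\ne\emptyset\}$. An unbiased random quantizer (URQ) with parameter $\alpha$ (finite, positive) is a random mapping $Q:\mathbb{R}^d\to\mathbb{R}^d$ such that for every $v\in\mathbb{R}^d$: $\mathrm{supp}(Q(v))\subseteq\mathrm{supp}(v)$, $\mathbf{E}\{Q(v)\}=v$, and $\mathbf{E}\{\|Q(v)\|^2\}\le\alpha\|v\|^2$. The constant $\beta$ is finite and positive, with $\beta\le\alpha-1$. Each application of $Q$ in the algorithm uses fresh randomness, so these properties hold conditionally on the past iterates. *)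

theory Defs
  imports "HOL-Probability.Probability"
begin

definition supp :: "real ^ 'd \<Rightarrow> 'd set" where
  "supp x = {i. x $ i \<noteq> 0}"

definition grad :: "(real ^ 'd \<Rightarrow> real) \<Rightarrow> real ^ 'd \<Rightarrow> real ^ 'd" where
  "grad f x = (THE g. GDERIV f x :> g)"

text \<open>Convexity and Lipschitz continuity of the gradient with constant \<open>L\<close>, in the form of the
  two-sided first-order bound. Differentiability is required explicitly because \<open>grad\<close> is
  a total function, unspecified where no gradient exists.\<close>

definition convex_smooth :: "real \<Rightarrow> (real ^ 'd \<Rightarrow> real) \<Rightarrow> bool" where
  "convex_smooth L f \<longleftrightarrow>
     (\<forall>x. f differentiable (at x)) \<and>
     (\<forall>x y. f x + grad f x \<bullet> (y - x) \<le> f y \<and>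
            f y \<le> f x + grad f x \<bullet> (y - x) + L / 2 * (norm (y - x))\<^sup>2)"

definition conflict_degree :: "nat \<Rightarrow> (nat \<Rightarrow> real ^ 'd) \<Rightarrow> nat \<Rightarrow> real" where
  "conflict_degree m a i = (\<Sum>j\<in>{1..m} - {i}. of_bool (supp (a i) \<inter> supp (a j) \<noteq> {}))"

definition Delta_ave :: "nat \<Rightarrow> (nat \<Rightarrow> real ^ 'd) \<Rightarrow> real" where
  "Delta_ave m a = 1 / real m * (\<Sum>i=1..m. conflict_degree m a i)"

definition Delta_max :: "nat \<Rightarrow> (nat \<Rightarrow> real ^ 'd) \<Rightarrow> real" where
  "Delta_max m a = Max (conflict_degree m a ` {1..m})"

text \<open>A random mapping is represented as a function \<open>Q s v\<close> of a random seed \<open>s\<close> with law \<open>N\<close> and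
  the argument \<open>v\<close>. It is measurable in both jointly, so that evaluating it at a random argument
  gives a random vector. The support condition holds almost surely for each \<open>v\<close>. Integrability
  is explicit because the Bochner integral of a non-integrable function is 0.\<close>

definition unbiased_random_quantizer ::
  "'s measure \<Rightarrow> ('s \<Rightarrow> real ^ 'd \<Rightarrow> real ^ 'd) \<Rightarrow> real \<Rightarrow> bool" where
  "unbiased_random_quantizer N Q \<alpha> \<longleftrightarrow>
     prob_space N \<and> 0 < \<alpha> \<and>
     (\<lambda>(s, v). Q s v) \<in> borel_measurable (N \<Otimes>\<^sub>M borel) \<and>
     (\<forall>v. (AE s in N. supp (Q s v) \<subseteq> supp v) \<and>
          integrable N (\<lambda>s. Q s v) \<and>
          (\<integral>s. Q s v \<partial>N) = v \<and>
          integrable N (\<lambda>s. (norm (Q s v))\<^sup>2) \<and>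
          (\<integral>s. (norm (Q s v))\<^sup>2 \<partial>N) \<le> \<alpha> * (norm v)\<^sup>2)"

text \<open>Iterates of the delayed quantized gradient method; \<open>\<xi> k i\<close> is the seed used for the \<open>i\<close>-th
  quantization in step \<open>k\<close>. Subtraction on \<open>nat\<close> truncates at 0, so \<open>x (k - \<tau> k i)\<close> is the initial
  point whenever the delay exceeds \<open>k\<close>, as the convention \<open>x\<^sub>k = x\<^sub>0\<close> for \<open>k < 0\<close> demands.\<close>

definition delayed_quantized_gradient_iterates ::
  "nat \<Rightarrow> (nat \<Rightarrow> real ^ 'd \<Rightarrow> real) \<Rightarrow> ('s \<Rightarrow> real ^ 'd \<Rightarrow> real ^ 'd) \<Rightarrow> (nat \<Rightarrow> nat \<Rightarrow> nat) \<Rightarrow> real \<Rightarrow>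
   real ^ 'd \<Rightarrow> 'w measure \<Rightarrow> (nat \<Rightarrow> nat \<Rightarrow> 'w \<Rightarrow> 's) \<Rightarrow> (nat \<Rightarrow> 'w \<Rightarrow> real ^ 'd) \<Rightarrow> bool" where
  "delayed_quantized_gradient_iterates m f Q \<tau> \<gamma> x0 M \<xi> x \<longleftrightarrow>
     (\<forall>\<omega>\<in>space M. x 0 \<omega> = x0 \<and>
        (\<forall>k. x (Suc k) \<omega> =
               x k \<omega> - \<gamma> *\<^sub>R (\<Sum>i=1..m. Q (\<xi> k i \<omega>) (grad (f i) (x (k - \<tau> k i) \<omega>)))))"

text \<open>Fresh randomness: the seeds of all quantizer applications are mutually independent, each
  distributed according to \<open>N\<close>.\<close>

definition fresh_seeds ::
  "nat \<Rightarrow> 'w measure \<Rightarrow> 's measure \<Rightarrow> (nat \<Rightarrow> nat \<Rightarrow> 'w \<Rightarrow> 's) \<Rightarrow> bool" where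
  "fresh_seeds m M N \<xi> \<longleftrightarrow>
     prob_space.indep_vars M (\<lambda>_. N) (\<lambda>(k, i). \<xi> k i) (UNIV \<times> {1..m}) \<and>
     (\<forall>k. \<forall>i\<in>{1..m}. distr M N (\<xi> k i) = N)"

end

theory Submission
  imports Defs
begin

text \<open>
  The argument separates a deterministic inequality, valid along every sample path, from two facts
  about the quantization noise.

  Write \<open>D\<^sub>k\<close> for the gradient of \<open>F\<close> at \<open>x\<^sub>k\<close>, \<open>h\<^sub>k\<close> for the sum of the delayed gradients used in step \<open>k\<close>,
  and \<open>n\<^sub>k\<close> for the total quantization noise of that step, so that the step is
  \<open>- \<gamma> (h\<^sub>k + n\<^sub>k)\<close>. The gradient of \<open>F\<close> is Lipschitz with constant \<open>Lbar\<close>, since the gradient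
  differences of two distinct components that are not adjacent in the conflict graph are orthogonal
  (\<open>norm_sum_sparse_le\<close>). For the same reason \<open>D\<^sub>k - h\<^sub>k\<close> is at most \<open>Lbar\<close> times the largest
  distance that the iterate moved within the delay. The descent inequality for \<open>F\<close> together with
  \<open>- 2 D\<^sub>k \<bullet> h\<^sub>k = \<parallel>D\<^sub>k - h\<^sub>k\<parallel>\<^sup>2 - \<parallel>D\<^sub>k\<parallel>\<^sup>2 - \<parallel>h\<^sub>k\<parallel>\<^sup>2\<close> then bounds each decrease of \<open>F\<close>. After summation
  over \<open>k\<close>, the movement terms and the quadratic terms are together at most
  \<open>(\<tau>\<^sup>2 u\<^sup>2 + u) \<Sum> \<parallel>h\<^sub>k + n\<^sub>k\<parallel>\<^sup>2\<close> times \<open>\<gamma> / 2\<close>, where \<open>u = \<gamma> Lbar\<close>. The step size condition makes the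
  factor at most \<open>1\<close>. Expanding the remaining square cancels \<open>\<Sum> \<parallel>h\<^sub>k\<parallel>\<^sup>2\<close> exactly and leaves, for
  every \<open>T\<close> (\<open>perturbed_delayed_descent\<close>)
  \<open>\<gamma>/2 \<Sum> \<parallel>D\<^sub>k\<parallel>\<^sup>2 \<le> F x\<^sub>0 - F x\<^sub>T + \<Sum> (\<gamma> (h\<^sub>k - D\<^sub>k) \<bullet> n\<^sub>k + \<gamma>/2 \<parallel>n\<^sub>k\<parallel>\<^sup>2)\<close>.

  In expectation the cross term vanishes, because \<open>h\<^sub>k - D\<^sub>k\<close> depends only on earlier seeds
  and the quantizer is unbiased. The noise of different components is uncorrelated, because their
  seeds are independent, so the expectation of \<open>\<parallel>n\<^sub>k\<parallel>\<^sup>2\<close> is at most \<open>m \<beta> C\<^sup>2\<close> (\<open>aggregated_noise\<close>).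
  This is at most \<open>e\<close>, as \<open>\<sigma> \<ge> 1\<close>. Bounding \<open>F\<close> below by \<open>Fstar\<close> pathwise,
  before taking expectations, avoids any question of integrability of \<open>F x\<^sub>k\<close>.
\<close>

section \<open>Gradients of convex smooth functions\<close>

lemma grad_eqI:
  assumes "GDERIV f x :> g"
  shows "grad f x = g"
  unfolding grad_def
proof (rule the_equality)
  show "GDERIV f x :> g" by (rule assms)
next
  fix h assume "GDERIV f x :> h"
  then have "(\<lambda>v. v \<bullet> h) = (\<lambda>v. v \<bullet> g)"
    using assms unfolding gderiv_def by (rule has_derivative_unique)
  then show "h = g"
    by (metis inner_commute vector_eq_rdot)
qed

lemma GDERIV_grad:
  fixes f :: "real ^ 'd \<Rightarrow> real"
  assumes "f differentiable (at x)"
  shows "GDERIV f x :> grad f x"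
proof -
  obtain f' where f': "(f has_derivative f') (at x)"
    using assms by (auto simp: differentiable_def)
  then have "linear f'"
    by (rule has_derivative_linear)
  then have "f' = (\<lambda>v. v \<bullet> adjoint f' 1)"
    using adjoint_works[of f' _ 1] by fastforce
  then have "GDERIV f x :> adjoint f' 1"
    using f' by (simp add: gderiv_def)
  then show ?thesis
    using grad_eqI by metis
qed

lemma GDERIV_sum:
  assumes "\<And>i. i \<in> I \<Longrightarrow> GDERIV (f i) x :> g i"
  shows "GDERIV (\<lambda>z. \<Sum>i\<in>I. f i z) x :> (\<Sum>i\<in>I. g i)"
  using assms unfolding gderiv_def inner_sum_right by (rule has_derivative_sum)

text \<open>Comparing, at a well chosen point, the upper bound from \<open>v\<close> with the convexity lower bound
  from \<open>u\<close> improves the convexity inequality by a quadratic gap. Adding the gaps for both orders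
  of the points gives cocoercivity of the gradient, which implies the Lipschitz bound by
  Cauchy-Schwarz.\<close>

lemma convex_smooth_grad_lipschitz:
  fixes f :: "real ^ 'd \<Rightarrow> real"
  assumes "convex_smooth L f" and L: "L > 0"
  shows "norm (grad f y - grad f x) \<le> L * norm (y - x)"
proof -
  have lower: "f u + grad f u \<bullet> (v - u) \<le> f v"
    and upper: "f v \<le> f u + grad f u \<bullet> (v - u) + L / 2 * (norm (v - u))\<^sup>2" for u v
    using assms(1) by (auto simp: convex_smooth_def)
  have gap: "f u + grad f u \<bullet> (v - u) + (norm (grad f v - grad f u))\<^sup>2 / (2 * L) \<le> f v" for u v
  proof -
    define w where "w = grad f v - grad f u"
    \<comment> \<open>This point minimizes over \<open>z\<close> the upper bound from \<open>v\<close> minus the lower bound from \<open>u\<close>.\<close>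
    define z where "z = v - (1 / L) *\<^sub>R w"
    have "grad f u \<bullet> (z - u) = grad f u \<bullet> (v - u) - (1 / L) * (grad f u \<bullet> w)"
      by (simp add: z_def inner_diff_right)
    moreover have "grad f v \<bullet> (z - v) = - (1 / L) * (grad f v \<bullet> w)"
      by (simp add: z_def inner_diff_right)
    moreover have "L / 2 * (norm (z - v))\<^sup>2 = (norm w)\<^sup>2 / (2 * L)"
      using L by (simp add: z_def power_divide field_simps power2_eq_square)
    moreover have "(1 / L) * (grad f v \<bullet> w) - (1 / L) * (grad f u \<bullet> w) = (norm w)\<^sup>2 / L"
      by (simp add: w_def power2_norm_eq_inner inner_diff_left right_diff_distrib diff_divide_distrib)
    moreover have "(norm w)\<^sup>2 / L = (norm w)\<^sup>2 / (2 * L) + (norm w)\<^sup>2 / (2 * L)"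
      by simp
    ultimately have "f u + grad f u \<bullet> (v - u) + (norm w)\<^sup>2 / (2 * L) \<le> f v"
      using lower[of u z] upper[of z v] by linarith
    then show ?thesis by (simp add: w_def)
  qed
  define w where "w = grad f y - grad f x"
  have "(norm w)\<^sup>2 / (2 * L) + (norm w)\<^sup>2 / (2 * L) \<le> w \<bullet> (y - x)"
    using gap[of x y] gap[of y x]
    by (simp add: w_def norm_minus_commute inner_diff_left inner_diff_right)
  moreover have "(norm w)\<^sup>2 / (2 * L) + (norm w)\<^sup>2 / (2 * L) = (norm w)\<^sup>2 / L"
    by simp
  ultimately have "(norm w)\<^sup>2 / L \<le> norm w * norm (y - x)"
    using norm_cauchy_schwarz[of w "y - x"] by linarith
  then have "norm w * norm w \<le> norm w * (L * norm (y - x))"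
    using L by (simp add: power2_eq_square field_simps)
  then have "norm w \<le> L * norm (y - x)"
    using L by (cases "norm w = 0") (auto simp: mult_le_cancel_left)
  then show ?thesis by (simp add: w_def)
qed

text \<open>Along the segment from \<open>y\<close> to \<open>z\<close>, the difference between \<open>F\<close> and the claimed quadratic bound has
  a nonpositive derivative.\<close>

lemma lipschitz_gradient_descent_bound:
  fixes F :: "'a::real_inner \<Rightarrow> real"
  assumes deriv: "\<And>z. GDERIV F z :> G z"
    and lip: "\<And>y z. norm (G z - G y) \<le> \<Lambda> * norm (z - y)"
  shows "F z \<le> F y + G y \<bullet> (z - y) + \<Lambda> / 2 * (norm (z - y))\<^sup>2"
proof -
  define d where "d = z - y"
  define \<phi> where "\<phi> t = F (y + t *\<^sub>R d) - t * (G y \<bullet> d) - \<Lambda> / 2 * t\<^sup>2 * (norm d)\<^sup>2" for t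
  have deriv_\<phi>: "(\<phi> has_real_derivative (G (y + t *\<^sub>R d) - G y) \<bullet> d - \<Lambda> * t * (norm d)\<^sup>2) (at t)" for t
  proof -
    have "((\<lambda>t. F (y + t *\<^sub>R d)) has_derivative (\<lambda>h. (h *\<^sub>R d) \<bullet> G (y + t *\<^sub>R d))) (at t)"
      by (rule has_derivative_compose[where f = "\<lambda>t. y + t *\<^sub>R d"])
         (use deriv[of "y + t *\<^sub>R d"] in \<open>auto simp: gderiv_def intro!: derivative_eq_intros\<close>)
    then have "((\<lambda>t. F (y + t *\<^sub>R d)) has_real_derivative G (y + t *\<^sub>R d) \<bullet> d) (at t)"
      by (simp add: has_field_derivative_def inner_commute mult_commute_abs)
    then show ?thesis
      unfolding \<phi>_def by (auto intro!: derivative_eq_intros simp: inner_diff_left)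
  qed
  have "\<phi> 1 \<le> \<phi> 0"
  proof (rule DERIV_nonpos_imp_nonincreasing[of 0 1])
    fix t :: real assume t: "0 \<le> t" "t \<le> 1"
    have "(G (y + t *\<^sub>R d) - G y) \<bullet> d \<le> norm (G (y + t *\<^sub>R d) - G y) * norm d"
      by (rule norm_cauchy_schwarz)
    also have "\<dots> \<le> (\<Lambda> * norm (t *\<^sub>R d)) * norm d"
      using lip[of "y + t *\<^sub>R d" y] by (intro mult_right_mono) auto
    also have "\<dots> = \<Lambda> * t * (norm d)\<^sup>2"
      using t by (simp add: power2_eq_square)
    finally show "\<exists>c. (\<phi> has_real_derivative c) (at t) \<and> c \<le> 0"
      using deriv_\<phi>[of t] by (intro exI conjI) auto
  qed simp
  then show ?thesis
    by (simp add: \<phi>_def d_def)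
qed

section \<open>The conflict graph\<close>

lemma supp_diff_subset: "supp (u - v) \<subseteq> supp u \<union> supp v"
  by (auto simp: supp_def)

lemma inner_eq_0_if_supp_disjoint:
  assumes "supp u \<inter> supp v = {}"
  shows "u \<bullet> v = 0"
  using assms unfolding inner_vec_def supp_def by (intro sum.neutral) auto

lemma conflict_degree_nonneg: "0 \<le> conflict_degree m a i"
  unfolding conflict_degree_def by (intro sum_nonneg) auto

lemma Delta_ave_nonneg: "0 \<le> Delta_ave m a"
  unfolding Delta_ave_def by (intro mult_nonneg_nonneg sum_nonneg conflict_degree_nonneg) auto

lemma Delta_ave_le_Delta_max:
  assumes "m \<ge> 1"
  shows "Delta_ave m a \<le> Delta_max m a"
proof -
  have "(\<Sum>i=1..m. conflict_degree m a i) \<le> (\<Sum>i=1..m. Delta_max m a)"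
    unfolding Delta_max_def by (intro sum_mono Max_ge) auto
  then show ?thesis
    using assms by (simp add: Delta_ave_def field_simps)
qed

text \<open>Expanding the square of the norm gives \<open>m\<^sup>2\<close> inner products, of which only the diagonal ones and
  those of conflicting pairs can be nonzero. There are \<open>m (1 + Delta_ave m a)\<close> of these.\<close>

lemma norm_sum_sparse_le:
  fixes a v :: "nat \<Rightarrow> real ^ 'd"
  assumes "m \<ge> 1" and R: "0 \<le> R"
    and supp: "\<And>i. i \<in> {1..m} \<Longrightarrow> supp (v i) \<subseteq> supp (a i)"
    and bound: "\<And>i. i \<in> {1..m} \<Longrightarrow> norm (v i) \<le> R"
  shows "norm (\<Sum>i=1..m. v i) \<le> sqrt (real m * (1 + Delta_ave m a)) * R"
proof -
  have row: "v i \<bullet> (\<Sum>j=1..m. v j) \<le> (1 + conflict_degree m a i) * R\<^sup>2" if i: "i \<in> {1..m}" for i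
  proof -
    have pair: "v i \<bullet> v j \<le> R\<^sup>2" if "j \<in> {1..m}" for j
    proof -
      have "v i \<bullet> v j \<le> norm (v i) * norm (v j)"
        by (rule norm_cauchy_schwarz)
      also have "\<dots> \<le> R * R"
        using bound i that R by (intro mult_mono) auto
      finally show ?thesis by (simp add: power2_eq_square)
    qed
    have "v i \<bullet> v j \<le> of_bool (supp (a i) \<inter> supp (a j) \<noteq> {}) * R\<^sup>2" if j: "j \<in> {1..m} - {i}" for j
    proof (cases "supp (a i) \<inter> supp (a j) = {}")
      case True
      then have "supp (v i) \<inter> supp (v j) = {}"
        using supp[OF i] supp[of j] j by blast
      then show ?thesis
        using True by (simp add: inner_eq_0_if_supp_disjoint)
    qed (use pair j in auto)
    then have "(\<Sum>j\<in>{1..m} - {i}. v i \<bullet> v j) \<le> conflict_degree m a i * R\<^sup>2"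
      unfolding conflict_degree_def sum_distrib_right by (rule sum_mono)
    moreover have "v i \<bullet> (\<Sum>j=1..m. v j) = v i \<bullet> v i + (\<Sum>j\<in>{1..m} - {i}. v i \<bullet> v j)"
      unfolding inner_sum_right using i by (intro sum.remove) auto
    ultimately show ?thesis
      using pair[OF i] by (simp add: algebra_simps)
  qed
  have "(norm (\<Sum>i=1..m. v i))\<^sup>2 = (\<Sum>i=1..m. v i \<bullet> (\<Sum>j=1..m. v j))"
    by (simp only: power2_norm_eq_inner inner_sum_left)
  also have "\<dots> \<le> (\<Sum>i=1..m. (1 + conflict_degree m a i) * R\<^sup>2)"
    using row by (rule sum_mono)
  also have "\<dots> = real m * (1 + Delta_ave m a) * R\<^sup>2"
    using \<open>m \<ge> 1\<close>
    by (simp add: Delta_ave_def sum_distrib_right[symmetric] sum.distrib distrib_left)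
  finally have "(norm (\<Sum>i=1..m. v i))\<^sup>2 \<le> real m * (1 + Delta_ave m a) * R\<^sup>2" .
  then have "norm (\<Sum>i=1..m. v i) \<le> sqrt (real m * (1 + Delta_ave m a) * R\<^sup>2)"
    by (rule real_le_rsqrt)
  then show ?thesis
    using R by (simp add: real_sqrt_mult)
qed

section \<open>Perturbed gradient descent with delays\<close>

lemma norm_sum_squared_le_card:
  fixes v :: "'i \<Rightarrow> 'a::real_normed_vector"
  assumes "finite A" and "card A \<le> n"
  shows "(norm (\<Sum>j\<in>A. v j))\<^sup>2 \<le> real n * (\<Sum>j\<in>A. (norm (v j))\<^sup>2)"
proof -
  have "(norm (\<Sum>j\<in>A. v j))\<^sup>2 \<le> (\<Sum>j\<in>A. norm (v j))\<^sup>2"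
    by (intro power_mono norm_sum norm_ge_zero)
  also have "\<dots> \<le> (\<Sum>j\<in>A. (norm (v j))\<^sup>2) * real (card A)"
    using sum_squared_le_sum_of_squares[of "\<lambda>j. norm (v j)" A] by (simp add: mult.commute)
  also have "\<dots> \<le> (\<Sum>j\<in>A. (norm (v j))\<^sup>2) * real n"
    using assms(2) by (intro mult_left_mono sum_nonneg) auto
  finally show ?thesis by (simp add: mult.commute)
qed

text \<open>Each index \<open>j\<close> lies in at most \<open>\<tau>\<close> of the windows, those with \<open>j < k \<le> j + \<tau>\<close>.\<close>

lemma sum_window_le:
  fixes c :: "nat \<Rightarrow> real"
  assumes "\<And>j. 0 \<le> c j"
  shows "(\<Sum>k<n. \<Sum>j\<in>{k-\<tau>..<k}. c j) \<le> real \<tau> * (\<Sum>j<n. c j)"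
proof -
  have "(\<Sum>k<n. \<Sum>j\<in>{k-\<tau>..<k}. c j) = (\<Sum>k<n. \<Sum>j\<in>{j. j < n \<and> k - \<tau> \<le> j \<and> j < k}. c j)"
    by (intro sum.cong) auto
  also have "\<dots> = (\<Sum>j<n. \<Sum>k\<in>{k. k < n \<and> k - \<tau> \<le> j \<and> j < k}. c j)"
    using sum.swap_restrict[of "{..<n}" "{..<n}" "\<lambda>k j. c j" "\<lambda>k j. k - \<tau> \<le> j \<and> j < k"]
    by simp
  also have "\<dots> \<le> (\<Sum>j<n. real \<tau> * c j)"
  proof (rule sum_mono)
    fix j
    have "card {k. k < n \<and> k - \<tau> \<le> j \<and> j < k} \<le> card {j<..j + \<tau>}"
      by (intro card_mono) auto
    then show "(\<Sum>k\<in>{k. k < n \<and> k - \<tau> \<le> j \<and> j < k}. c j) \<le> real \<tau> * c j"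
      using assms[of j] by (auto intro: mult_right_mono)
  qed
  finally show ?thesis by (simp add: sum_distrib_left)
qed

text \<open>The family \<open>n\<close> is an arbitrary perturbation of the steps. It enters the result only linearly,
  against the gradient error \<open>h k - G (x k)\<close>, and through its own square, so that an unbiased
  perturbation costs no more than its variance. The assumption \<open>drift\<close> is the Lipschitz property of
  the gradient when every summand is evaluated at a point of its own.\<close>

lemma perturbed_delayed_descent:
  fixes F :: "'a::real_inner \<Rightarrow> real" and x n :: "nat \<Rightarrow> 'a"
  assumes descent: "\<And>y z. F z \<le> F y + G y \<bullet> (z - y) + \<Lambda> / 2 * (norm (z - y))\<^sup>2"
    and drift: "\<And>y z R. (\<And>i. i \<in> I \<Longrightarrow> norm (y - z i) \<le> R) \<Longrightarrow> 0 \<le> R \<Longrightarrow>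
                  norm (G y - (\<Sum>i\<in>I. g i (z i))) \<le> \<Lambda> * R"
    and \<gamma>: "0 < \<gamma>" and \<Lambda>: "0 \<le> \<Lambda>"
    and step: "real \<tau>^2 * (\<gamma> * \<Lambda>)\<^sup>2 + \<gamma> * \<Lambda> \<le> 1"
    and delay: "\<And>k i. i \<in> I \<Longrightarrow> delay k i \<le> \<tau>"
    and h: "\<And>k. h k = (\<Sum>i\<in>I. g i (x (k - delay k i)))"
    and iter: "\<And>k. x (Suc k) = x k - \<gamma> *\<^sub>R (h k + n k)"
  shows "\<gamma> / 2 * (\<Sum>k<T. (norm (G (x k)))\<^sup>2)
           \<le> F (x 0) - F (x T) + (\<Sum>k<T. \<gamma> * ((h k - G (x k)) \<bullet> n k) + \<gamma> / 2 * (norm (n k))\<^sup>2)"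
proof -
  define q where "q k = h k + n k" for k
  define S where "S k = (\<Sum>j\<in>{k-\<tau>..<k}. (norm (q j))\<^sup>2)" for k
  define u where "u = \<gamma> * \<Lambda>"
  have S_nonneg: "0 \<le> S k" for k
    unfolding S_def by (intro sum_nonneg) auto
  \<comment> \<open>Cauchy-Schwarz over the at most \<open>\<tau>\<close> steps that lie between a delayed iterate and the current one.\<close>
  have window: "norm (x k - x (k - d)) \<le> \<gamma> * sqrt (real \<tau> * S k)" if d: "d \<le> \<tau>" for k d
  proof -
    have "x k - x (k - d) = (\<Sum>j\<in>{k-d..<k}. x (Suc j) - x j)"
      by (subst sum_Suc_diff') auto
    also have "\<dots> = - (\<gamma> *\<^sub>R (\<Sum>j\<in>{k-d..<k}. q j))"
      by (simp add: iter q_def scaleR_sum_right sum_negf)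
    finally have "norm (x k - x (k - d)) = \<gamma> * norm (\<Sum>j\<in>{k-d..<k}. q j)"
      using \<gamma> by simp
    moreover have "(norm (\<Sum>j\<in>{k-d..<k}. q j))\<^sup>2 \<le> real \<tau> * S k"
    proof -
      have "(norm (\<Sum>j\<in>{k-d..<k}. q j))\<^sup>2 \<le> real \<tau> * (\<Sum>j\<in>{k-d..<k}. (norm (q j))\<^sup>2)"
        using d by (intro norm_sum_squared_le_card) auto
      also have "\<dots> \<le> real \<tau> * S k"
        unfolding S_def using d by (intro mult_left_mono sum_mono2) auto
      finally show ?thesis .
    qed
    ultimately show ?thesis
      using \<gamma> by (auto intro!: mult_left_mono real_le_rsqrt)
  qed
  have stale: "(norm (G (x k) - h k))\<^sup>2 \<le> u\<^sup>2 * (real \<tau> * S k)" for k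
  proof -
    have "norm (G (x k) - h k) \<le> \<Lambda> * (\<gamma> * sqrt (real \<tau> * S k))"
      unfolding h using window delay \<gamma> S_nonneg by (intro drift) auto
    then have "(norm (G (x k) - h k))\<^sup>2 \<le> (\<Lambda> * (\<gamma> * sqrt (real \<tau> * S k)))\<^sup>2"
      by (intro power_mono) auto
    then show ?thesis
      using S_nonneg[of k] by (simp add: u_def power_mult_distrib mult_ac)
  qed
  have one_step: "F (x (Suc k)) - F (x k) \<le> - (\<gamma> / 2) * (norm (G (x k)))\<^sup>2 - \<gamma> / 2 * (norm (h k))\<^sup>2
      - \<gamma> * (G (x k) \<bullet> n k) + \<gamma> / 2 * (u\<^sup>2 * (real \<tau> * S k)) + \<gamma> / 2 * (u * (norm (q k))\<^sup>2)" for k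
  proof -
    have "F (x (Suc k)) - F (x k) \<le> - \<gamma> * (G (x k) \<bullet> q k) + \<Lambda> / 2 * (\<gamma>\<^sup>2 * (norm (q k))\<^sup>2)"
      using descent[where y="x k" and z="x (Suc k)"] by (simp add: iter q_def power_mult_distrib)
    moreover have "\<Lambda> / 2 * (\<gamma>\<^sup>2 * (norm (q k))\<^sup>2) = \<gamma> / 2 * (u * (norm (q k))\<^sup>2)"
      by (simp add: u_def power2_eq_square)
    moreover have "(norm (G (x k) - h k))\<^sup>2 = (norm (G (x k)))\<^sup>2 + (norm (h k))\<^sup>2 - 2 * (G (x k) \<bullet> h k)"
      by (simp add: power2_norm_eq_inner inner_diff_left inner_diff_right inner_commute)
    then have "- \<gamma> * (G (x k) \<bullet> q k) = - (\<gamma> / 2) * (norm (G (x k)))\<^sup>2 - \<gamma> / 2 * (norm (h k))\<^sup>2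
      - \<gamma> * (G (x k) \<bullet> n k) + \<gamma> / 2 * (norm (G (x k) - h k))\<^sup>2"
      by (simp add: q_def inner_add_right distrib_left right_diff_distrib)
    moreover have "\<gamma> / 2 * (norm (G (x k) - h k))\<^sup>2 \<le> \<gamma> / 2 * (u\<^sup>2 * (real \<tau> * S k))"
      using stale[of k] \<gamma> by (intro mult_left_mono) auto
    ultimately show ?thesis by linarith
  qed
  have "(\<Sum>k<T. u\<^sup>2 * (real \<tau> * S k) + u * (norm (q k))\<^sup>2) \<le> (\<Sum>k<T. (norm (q k))\<^sup>2)"
  proof -
    let ?X = "\<Sum>k<T. (norm (q k))\<^sup>2"
    have "(\<Sum>k<T. u\<^sup>2 * (real \<tau> * S k) + u * (norm (q k))\<^sup>2) = u\<^sup>2 * real \<tau> * (\<Sum>k<T. S k) + u * ?X"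
      by (simp add: sum.distrib sum_distrib_left mult.assoc)
    also have "\<dots> \<le> u\<^sup>2 * real \<tau> * (real \<tau> * ?X) + u * ?X"
      unfolding S_def by (intro add_right_mono mult_left_mono sum_window_le) auto
    also have "\<dots> = (real \<tau>^2 * u\<^sup>2 + u) * ?X"
      by (simp add: algebra_simps power2_eq_square)
    also have "\<dots> \<le> 1 * ?X"
      using step by (intro mult_right_mono sum_nonneg) (auto simp: u_def)
    finally show ?thesis by simp
  qed
  then have steps: "\<gamma> / 2 * (\<Sum>k<T. u\<^sup>2 * (real \<tau> * S k) + u * (norm (q k))\<^sup>2) \<le> \<gamma> / 2 * (\<Sum>k<T. (norm (q k))\<^sup>2)"
    using \<gamma> by (intro mult_left_mono) auto
  have "F (x T) - F (x 0) = (\<Sum>k<T. F (x (Suc k)) - F (x k))"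
    by (rule sum_lessThan_telescope[symmetric])
  also have "\<dots> \<le> (\<Sum>k<T. - (\<gamma> / 2) * (norm (G (x k)))\<^sup>2 - \<gamma> / 2 * (norm (h k))\<^sup>2
      - \<gamma> * (G (x k) \<bullet> n k) + \<gamma> / 2 * (u\<^sup>2 * (real \<tau> * S k)) + \<gamma> / 2 * (u * (norm (q k))\<^sup>2))"
    using one_step by (rule sum_mono)
  also have "\<dots> = (\<Sum>k<T. - (\<gamma> / 2) * (norm (G (x k)))\<^sup>2 - \<gamma> / 2 * (norm (h k))\<^sup>2 - \<gamma> * (G (x k) \<bullet> n k))
      + \<gamma> / 2 * (\<Sum>k<T. u\<^sup>2 * (real \<tau> * S k) + u * (norm (q k))\<^sup>2)"
    by (simp add: sum.distrib sum_distrib_left distrib_left)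
  also have "\<dots> \<le> (\<Sum>k<T. - (\<gamma> / 2) * (norm (G (x k)))\<^sup>2 - \<gamma> / 2 * (norm (h k))\<^sup>2 - \<gamma> * (G (x k) \<bullet> n k))
      + \<gamma> / 2 * (\<Sum>k<T. (norm (q k))\<^sup>2)"
    using steps by simp
  also have "\<dots> = (\<Sum>k<T. - (\<gamma> / 2) * (norm (G (x k)))\<^sup>2
      + (\<gamma> * ((h k - G (x k)) \<bullet> n k) + \<gamma> / 2 * (norm (n k))\<^sup>2))"
    unfolding sum_distrib_left sum.distrib[symmetric]
  proof (rule sum.cong[OF refl])
    fix k
    have "(norm (q k))\<^sup>2 = (norm (h k))\<^sup>2 + 2 * (h k \<bullet> n k) + (norm (n k))\<^sup>2"
      by (simp add: q_def power2_norm_eq_inner inner_add_left inner_add_right inner_commute)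
    then show "- (\<gamma> / 2) * (norm (G (x k)))\<^sup>2 - \<gamma> / 2 * (norm (h k))\<^sup>2 - \<gamma> * (G (x k) \<bullet> n k)
        + \<gamma> / 2 * (norm (q k))\<^sup>2
      = - (\<gamma> / 2) * (norm (G (x k)))\<^sup>2 + (\<gamma> * ((h k - G (x k)) \<bullet> n k) + \<gamma> / 2 * (norm (n k))\<^sup>2)"
      by (simp add: inner_diff_left algebra_simps)
  qed
  also have "\<dots> = - (\<gamma> / 2 * (\<Sum>k<T. (norm (G (x k)))\<^sup>2))
      + (\<Sum>k<T. \<gamma> * ((h k - G (x k)) \<bullet> n k) + \<gamma> / 2 * (norm (n k))\<^sup>2)"
    unfolding sum.distrib[of "\<lambda>k. - (\<gamma> / 2) * (norm (G (x k)))\<^sup>2"] by (simp add: sum_distrib_left sum_negf)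
  finally show ?thesis by linarith
qed

section \<open>Integrating out a fresh seed\<close>

text \<open>The \<sigma>-algebra \<open>A\<close> lives on the same sample space as \<open>M\<close> and holds the information available
  when the seed \<open>Z\<close> is drawn. The product rule says at once that \<open>Z\<close> has law \<open>N\<close> and that it is
  independent of \<open>A\<close>. It is stated by probabilities and not by \<open>indep_var\<close>, as sample
  points and seeds have different types.\<close>

locale fresh_seed = prob_space M + N: prob_space N
  for M :: "'w measure" and N :: "'s measure" +
  fixes A :: "'w measure" and Z :: "'w \<Rightarrow> 's"
  assumes sub[measurable]: "(\<lambda>\<omega>. \<omega>) \<in> measurable M A"
    and Z[measurable]: "Z \<in> measurable M N"
    and indep: "\<And>a B. a \<in> sets A \<Longrightarrow> B \<in> sets N \<Longrightarrow>
      emeasure M {\<omega> \<in> space M. \<omega> \<in> a \<and> Z \<omega> \<in> B} = emeasure M {\<omega> \<in> space M. \<omega> \<in> a} * emeasure N B"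
begin

text \<open>By the product rule, the joint law of the sample point, seen in \<open>A\<close>, and the seed is a product
  measure, so Fubini's theorem lets the seed be integrated first with everything that is
  \<open>A\<close>-measurable frozen.\<close>

lemma
  shows nn_integral_frozen: "\<phi> \<in> borel_measurable (A \<Otimes>\<^sub>M N) \<Longrightarrow>
      (\<integral>\<^sup>+\<omega>. \<phi> (\<omega>, Z \<omega>) \<partial>M) = (\<integral>\<^sup>+\<omega>. (\<integral>\<^sup>+s. \<phi> (\<omega>, s) \<partial>N) \<partial>M)"
    and integral_frozen: "\<psi> \<in> borel_measurable (A \<Otimes>\<^sub>M N) \<Longrightarrow> integrable M (\<lambda>\<omega>. \<psi> (\<omega>, Z \<omega>)) \<Longrightarrow>
      (\<integral>\<omega>. (\<psi> (\<omega>, Z \<omega>) :: real) \<partial>M) = (\<integral>\<omega>. (\<integral>s. \<psi> (\<omega>, s) \<partial>N) \<partial>M)"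
proof -
  define P where "P = distr M A (\<lambda>\<omega>. \<omega>)"
  interpret P: prob_space P
    unfolding P_def by (rule prob_space_distr) simp
  interpret PN: pair_prob_space P N ..
  have sets_P[measurable_cong]: "sets P = sets A"
    by (simp add: P_def)
  have pair: "P \<Otimes>\<^sub>M N = distr M (A \<Otimes>\<^sub>M N) (\<lambda>\<omega>. (\<omega>, Z \<omega>))"
  proof (rule pair_measure_eqI)
    show "sigma_finite_measure P" "sigma_finite_measure N" by unfold_locales
    show "sets (P \<Otimes>\<^sub>M N) = sets (distr M (A \<Otimes>\<^sub>M N) (\<lambda>\<omega>. (\<omega>, Z \<omega>)))"
      by (simp add: sets_P cong: sets_pair_measure_cong)
    fix a B assume a: "a \<in> sets P" and B[measurable]: "B \<in> sets N"
    then have [measurable]: "a \<in> sets A" by (simp add: sets_P)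
    have "emeasure P a = emeasure M {\<omega> \<in> space M. \<omega> \<in> a}"
      unfolding P_def by (subst emeasure_distr) (auto simp: vimage_def Int_def conj_commute)
    moreover have "emeasure (distr M (A \<Otimes>\<^sub>M N) (\<lambda>\<omega>. (\<omega>, Z \<omega>))) (a \<times> B)
        = emeasure M {\<omega> \<in> space M. \<omega> \<in> a \<and> Z \<omega> \<in> B}"
      by (subst emeasure_distr) (auto simp: vimage_def Int_def conj_ac)
    ultimately show "emeasure P a * emeasure N B = emeasure (distr M (A \<Otimes>\<^sub>M N) (\<lambda>\<omega>. (\<omega>, Z \<omega>))) (a \<times> B)"
      by (simp add: indep)
  qed
  {
    assume \<phi>[measurable]: "\<phi> \<in> borel_measurable (A \<Otimes>\<^sub>M N)"
    have "(\<integral>\<^sup>+\<omega>. \<phi> (\<omega>, Z \<omega>) \<partial>M) = (\<integral>\<^sup>+y. \<phi> y \<partial>(P \<Otimes>\<^sub>M N))"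
      unfolding pair by (subst nn_integral_distr) auto
    also have "\<dots> = (\<integral>\<^sup>+\<omega>. (\<integral>\<^sup>+s. \<phi> (\<omega>, s) \<partial>N) \<partial>P)"
      by (rule N.nn_integral_fst[symmetric]) measurable
    also have "\<dots> = (\<integral>\<^sup>+\<omega>. (\<integral>\<^sup>+s. \<phi> (\<omega>, s) \<partial>N) \<partial>M)"
      unfolding P_def by (rule nn_integral_distr) auto
    finally show "(\<integral>\<^sup>+\<omega>. \<phi> (\<omega>, Z \<omega>) \<partial>M) = (\<integral>\<^sup>+\<omega>. (\<integral>\<^sup>+s. \<phi> (\<omega>, s) \<partial>N) \<partial>M)" .
  next
    assume \<psi>[measurable]: "\<psi> \<in> borel_measurable (A \<Otimes>\<^sub>M N)"
      and int: "integrable M (\<lambda>\<omega>. \<psi> (\<omega>, Z \<omega>))"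
    have int': "integrable (P \<Otimes>\<^sub>M N) \<psi>"
      unfolding pair using int by (subst integrable_distr_eq) auto
    have "(\<integral>\<omega>. \<psi> (\<omega>, Z \<omega>) \<partial>M) = (\<integral>y. \<psi> y \<partial>(P \<Otimes>\<^sub>M N))"
      unfolding pair by (subst integral_distr) auto
    also have "\<dots> = (\<integral>\<omega>. (\<integral>s. \<psi> (\<omega>, s) \<partial>N) \<partial>P)"
      by (rule PN.integral_fst'[OF int', symmetric])
    also have "\<dots> = (\<integral>\<omega>. (\<integral>s. \<psi> (\<omega>, s) \<partial>N) \<partial>M)"
      unfolding P_def by (rule integral_distr) auto
    finally show "(\<integral>\<omega>. \<psi> (\<omega>, Z \<omega>) \<partial>M) = (\<integral>\<omega>. (\<integral>s. \<psi> (\<omega>, s) \<partial>N) \<partial>M)" .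
  }
qed

end

definition seed_algebra :: "'w measure \<Rightarrow> 's measure \<Rightarrow> ('p \<Rightarrow> 'w \<Rightarrow> 's) \<Rightarrow> 'p set \<Rightarrow> 'w measure" where
  "seed_algebra M N Z J = vimage_algebra (space M) (\<lambda>\<omega>. restrict (\<lambda>p. Z p \<omega>) J) (PiM J (\<lambda>_. N))"

lemma space_seed_algebra[simp]: "space (seed_algebra M N Z J) = space M"
  by (simp add: seed_algebra_def)

lemma measurable_seed_algebra:
  assumes Z: "\<And>p. p \<in> J \<Longrightarrow> Z p \<in> measurable M N" and p: "p \<in> J"
  shows "Z p \<in> measurable (seed_algebra M N Z J) N"
proof -
  let ?r = "\<lambda>\<omega>. restrict (\<lambda>p. Z p \<omega>) J"
  have "?r \<in> space M \<rightarrow> space (PiM J (\<lambda>_. N))"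
    using measurable_space[OF Z] by (auto simp: space_PiM)
  then have r: "?r \<in> measurable (seed_algebra M N Z J) (PiM J (\<lambda>_. N))"
    unfolding seed_algebra_def by (rule measurable_vimage_algebra1)
  have "(\<lambda>\<omega>. ?r \<omega> p) \<in> measurable (seed_algebra M N Z J) N"
    by (rule measurable_compose[OF r measurable_component_singleton[OF p]])
  then show ?thesis using p by simp
qed

lemma measurable_seed_algebra_mono:
  assumes Z: "\<And>p. p \<in> J' \<Longrightarrow> Z p \<in> measurable M N" and "J \<subseteq> J'"
    and g: "g \<in> measurable (seed_algebra M N Z J) B"
  shows "g \<in> measurable (seed_algebra M N Z J') B"
proof -
  have "(\<lambda>\<omega>. restrict (\<lambda>p. Z p \<omega>) J) \<in> measurable (seed_algebra M N Z J') (PiM J (\<lambda>_. N))"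
    using \<open>J \<subseteq> J'\<close> by (intro measurable_restrict measurable_seed_algebra Z) auto
  then have "(\<lambda>\<omega>. \<omega>) \<in> measurable (seed_algebra M N Z J') (seed_algebra M N Z J)"
    unfolding seed_algebra_def[of M N Z J] by (intro measurable_vimage_algebra2) auto
  from measurable_compose[OF this g] show ?thesis .
qed

text \<open>The seed \<open>Z p\<close> is independent of the block of seeds indexed by \<open>J\<close>. To compare variables
  of one type, it is viewed as an element of the product space over the singleton \<open>{p}\<close>.\<close>

lemma fresh_seed_seed_algebra:
  assumes "prob_space M" and indep: "prob_space.indep_vars M (\<lambda>_. N) Z I"
    and law: "distr M N (Z p) = N" and J: "J \<subseteq> I" and p: "p \<in> I" "p \<notin> J"
  shows "fresh_seed M N (seed_algebra M N Z J) (Z p)"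
proof -
  interpret prob_space M by fact
  let ?r = "\<lambda>J \<omega>. restrict (\<lambda>p. Z p \<omega>) J"
  let ?A = "seed_algebra M N Z J"
  have ind: "indep_var (PiM J (\<lambda>_. N)) (?r J) (PiM {p} (\<lambda>_. N)) (?r {p})"
    using J p by (intro indep_var_restrict[OF indep]) auto
  then have r: "?r J \<in> measurable M (PiM J (\<lambda>_. N))"
    by (rule indep_var_rv1)
  have Z[measurable]: "Z p \<in> measurable M N"
    using indep p by (auto simp: indep_vars_def)
  have sub[measurable]: "(\<lambda>\<omega>. \<omega>) \<in> measurable M ?A"
    unfolding seed_algebra_def by (rule measurable_vimage_algebra2) (use r in auto)
  have N: "prob_space N"
    using prob_space_distr[OF Z] law by simp
  have "emeasure M {\<omega> \<in> space M. \<omega> \<in> a \<and> Z p \<omega> \<in> B} = emeasure M {\<omega> \<in> space M. \<omega> \<in> a} * emeasure N B"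
    if a: "a \<in> sets ?A" and B[measurable]: "B \<in> sets N" for a B
  proof -
    have "sets ?A = {?r J -` A \<inter> space M | A. A \<in> sets (PiM J (\<lambda>_. N))}"
      unfolding seed_algebra_def using measurable_space[OF r] by (intro sets_vimage_algebra2) auto
    then obtain A where A: "A \<in> sets (PiM J (\<lambda>_. N))" and a_eq: "a = ?r J -` A \<inter> space M"
      using a by auto
    let ?B = "(\<lambda>y. y p) -` B \<inter> space (PiM {p} (\<lambda>_. N))"
    have B': "?B \<in> sets (PiM {p} (\<lambda>_. N))"
      by measurable
    have Zp: "?r {p} \<omega> \<in> ?B \<longleftrightarrow> Z p \<omega> \<in> B" if "\<omega> \<in> space M" for \<omega>
      using measurable_space[OF Z that] by (auto simp: space_PiM)
    have "prob ((\<lambda>\<omega>. (?r J \<omega>, ?r {p} \<omega>)) -` (A \<times> ?B) \<inter> space M)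
        = prob (?r J -` A \<inter> space M) * prob (?r {p} -` ?B \<inter> space M)"
      using indep_varD[OF ind A B'] .
    moreover have "(\<lambda>\<omega>. (?r J \<omega>, ?r {p} \<omega>)) -` (A \<times> ?B) \<inter> space M = {\<omega> \<in> space M. \<omega> \<in> a \<and> Z p \<omega> \<in> B}"
      using Zp unfolding a_eq by blast
    moreover have "?r {p} -` ?B \<inter> space M = Z p -` B \<inter> space M"
      using Zp by blast
    moreover have "?r J -` A \<inter> space M = {\<omega> \<in> space M. \<omega> \<in> a}"
      unfolding a_eq by blast
    moreover have "emeasure N B = emeasure M (Z p -` B \<inter> space M)"
      by (subst law[symmetric]) (simp add: emeasure_distr)
    ultimately show ?thesis
      by (simp add: emeasure_eq_measure ennreal_mult')
  qed
  then show ?thesis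
    using N sub Z by (intro fresh_seed.intro fresh_seed_axioms.intro prob_space_axioms) auto
qed

locale quantized_seed = fresh_seed M N A Z
  for M :: "'w measure" and N :: "'s measure" and A Z +
  fixes Q :: "'s \<Rightarrow> real ^ 'd \<Rightarrow> real ^ 'd" and \<alpha> \<beta> :: real
  assumes quantizer: "unbiased_random_quantizer N Q \<alpha>"
    and error: "\<And>v. (\<integral>s. (norm (Q s v - v))\<^sup>2 \<partial>N) \<le> \<beta> * (norm v)\<^sup>2"
begin

lemma measurable_Q[measurable]: "(\<lambda>(s, v). Q s v) \<in> borel_measurable (N \<Otimes>\<^sub>M borel)"
  using quantizer by (simp add: unbiased_random_quantizer_def)

text \<open>With the argument \<open>V\<close> frozen, this is the error bound of the quantizer. Nonnegative integrals are
  used first, so that integrability comes out as a result.\<close>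

lemma noise_second_moment:
  assumes V[measurable]: "V \<in> borel_measurable A" and C: "\<And>\<omega>. norm (V \<omega>) \<le> C" and \<beta>: "0 \<le> \<beta>"
  shows "integrable M (\<lambda>\<omega>. (norm (Q (Z \<omega>) (V \<omega>) - V \<omega>))\<^sup>2)"
    and "(\<integral>\<omega>. (norm (Q (Z \<omega>) (V \<omega>) - V \<omega>))\<^sup>2 \<partial>M) \<le> \<beta> * C\<^sup>2"
proof -
  have V'[measurable]: "V \<in> borel_measurable M"
    using measurable_compose[OF sub V] by simp
  have point: "(\<integral>\<^sup>+s. ennreal ((norm (Q s v - v))\<^sup>2) \<partial>N) \<le> ennreal (\<beta> * C\<^sup>2)" if v: "norm v \<le> C" for v
  proof -
    have int: "integrable N (\<lambda>s. Q s v)" "integrable N (\<lambda>s. (norm (Q s v))\<^sup>2)"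
      using quantizer by (auto simp: unbiased_random_quantizer_def)
    have "integrable N (\<lambda>s. (norm (Q s v))\<^sup>2 - 2 * (Q s v \<bullet> v) + (norm v)\<^sup>2)"
      using int by (intro Bochner_Integration.integrable_add Bochner_Integration.integrable_diff
          integrable_mult_right integrable_inner_left) auto
    then have "integrable N (\<lambda>s. (norm (Q s v - v))\<^sup>2)"
      by (simp add: power2_norm_eq_inner inner_diff_left inner_diff_right inner_commute algebra_simps)
    then have "(\<integral>\<^sup>+s. ennreal ((norm (Q s v - v))\<^sup>2) \<partial>N) = ennreal (\<integral>s. (norm (Q s v - v))\<^sup>2 \<partial>N)"
      by (intro nn_integral_eq_integral) auto
    also have "\<dots> \<le> ennreal (\<beta> * (norm v)\<^sup>2)"
      by (intro ennreal_leI error)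
    also have "\<dots> \<le> ennreal (\<beta> * C\<^sup>2)"
      using v \<beta> by (intro ennreal_leI mult_left_mono power_mono) auto
    finally show ?thesis .
  qed
  have "(\<integral>\<^sup>+\<omega>. ennreal ((norm (Q (Z \<omega>) (V \<omega>) - V \<omega>))\<^sup>2) \<partial>M)
      = (\<integral>\<^sup>+\<omega>. (\<integral>\<^sup>+s. ennreal ((norm (Q s (V \<omega>) - V \<omega>))\<^sup>2) \<partial>N) \<partial>M)"
    using nn_integral_frozen[of "\<lambda>(\<omega>, s). ennreal ((norm (Q s (V \<omega>) - V \<omega>))\<^sup>2)"] by simp
  also have "\<dots> \<le> (\<integral>\<^sup>+\<omega>. ennreal (\<beta> * C\<^sup>2) \<partial>M)"
    by (intro nn_integral_mono point C)
  finally have bound: "(\<integral>\<^sup>+\<omega>. ennreal ((norm (Q (Z \<omega>) (V \<omega>) - V \<omega>))\<^sup>2) \<partial>M) \<le> ennreal (\<beta> * C\<^sup>2)"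
    by (simp add: emeasure_space_1)
  show int: "integrable M (\<lambda>\<omega>. (norm (Q (Z \<omega>) (V \<omega>) - V \<omega>))\<^sup>2)"
    using bound by (intro integrableI_bounded) (auto intro: le_less_trans)
  show "(\<integral>\<omega>. (norm (Q (Z \<omega>) (V \<omega>) - V \<omega>))\<^sup>2 \<partial>M) \<le> \<beta> * C\<^sup>2"
    using bound \<beta> by (subst (asm) nn_integral_eq_integral[OF int]) (auto simp: ennreal_le_iff)
qed

text \<open>With \<open>V\<close> and \<open>W\<close> frozen, the inner integral vanishes because the quantizer is unbiased.\<close>

lemma noise_orthogonal:
  assumes V[measurable]: "V \<in> borel_measurable A" and W[measurable]: "W \<in> borel_measurable A"
    and int: "integrable M (\<lambda>\<omega>. W \<omega> \<bullet> (Q (Z \<omega>) (V \<omega>) - V \<omega>))"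
  shows "(\<integral>\<omega>. W \<omega> \<bullet> (Q (Z \<omega>) (V \<omega>) - V \<omega>) \<partial>M) = 0"
proof -
  have "(\<integral>s. w \<bullet> (Q s v - v) \<partial>N) = 0" for v w
  proof -
    have "integrable N (\<lambda>s. Q s v)" "(\<integral>s. Q s v \<partial>N) = v"
      using quantizer by (auto simp: unbiased_random_quantizer_def)
    then show ?thesis
      by (simp add: N.prob_space)
  qed
  then show ?thesis
    using integral_frozen[of "\<lambda>(\<omega>, s). W \<omega> \<bullet> (Q s (V \<omega>) - V \<omega>)"] int by simp
qed

end

lemma integrable_inner_if_square_integrable:
  fixes u v :: "'w \<Rightarrow> 'a::euclidean_space"
  assumes [measurable]: "u \<in> borel_measurable M" "v \<in> borel_measurable M"
    and "integrable M (\<lambda>\<omega>. (norm (u \<omega>))\<^sup>2)" "integrable M (\<lambda>\<omega>. (norm (v \<omega>))\<^sup>2)"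
  shows "integrable M (\<lambda>\<omega>. u \<omega> \<bullet> v \<omega>)"
proof (rule Bochner_Integration.integrable_bound)
  show "integrable M (\<lambda>\<omega>. (norm (u \<omega>))\<^sup>2 + (norm (v \<omega>))\<^sup>2)"
    using assms by simp
  have "\<bar>a \<bullet> b\<bar> \<le> (norm a)\<^sup>2 + (norm b)\<^sup>2" for a b :: 'a
  proof -
    have "0 \<le> norm a * norm b" by simp
    then show ?thesis
      using Cauchy_Schwarz_ineq2[of a b] sum_squares_bound[of "norm a" "norm b"] by linarith
  qed
  then show "AE \<omega> in M. norm (u \<omega> \<bullet> v \<omega>) \<le> norm ((norm (u \<omega>))\<^sup>2 + (norm (v \<omega>))\<^sup>2)"
    by simp
qed simp

lemma expected_square_sum_orthogonal:
  fixes v :: "'i \<Rightarrow> 'w \<Rightarrow> 'a::euclidean_space"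
  assumes "finite I"
    and meas: "\<And>i. i \<in> I \<Longrightarrow> v i \<in> borel_measurable M"
    and int: "\<And>i. i \<in> I \<Longrightarrow> integrable M (\<lambda>\<omega>. (norm (v i \<omega>))\<^sup>2)"
    and orth: "\<And>i j. i \<in> I \<Longrightarrow> j \<in> I \<Longrightarrow> i \<noteq> j \<Longrightarrow> (\<integral>\<omega>. v i \<omega> \<bullet> v j \<omega> \<partial>M) = 0"
  shows "integrable M (\<lambda>\<omega>. (norm (\<Sum>i\<in>I. v i \<omega>))\<^sup>2)"
    and "(\<integral>\<omega>. (norm (\<Sum>i\<in>I. v i \<omega>))\<^sup>2 \<partial>M) = (\<Sum>i\<in>I. \<integral>\<omega>. (norm (v i \<omega>))\<^sup>2 \<partial>M)"
proof -
  have eq: "(norm (\<Sum>i\<in>I. v i \<omega>))\<^sup>2 = (\<Sum>i\<in>I. \<Sum>j\<in>I. v i \<omega> \<bullet> v j \<omega>)" for \<omega>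
    unfolding power2_norm_eq_inner inner_sum_left inner_sum_right by (rule sum.swap)
  have int': "integrable M (\<lambda>\<omega>. v i \<omega> \<bullet> v j \<omega>)" if "i \<in> I" "j \<in> I" for i j
    using that by (intro integrable_inner_if_square_integrable meas int)
  show "integrable M (\<lambda>\<omega>. (norm (\<Sum>i\<in>I. v i \<omega>))\<^sup>2)"
    unfolding eq by (intro Bochner_Integration.integrable_sum int')
  have "(\<integral>\<omega>. (norm (\<Sum>i\<in>I. v i \<omega>))\<^sup>2 \<partial>M) = (\<Sum>i\<in>I. \<Sum>j\<in>I. \<integral>\<omega>. v i \<omega> \<bullet> v j \<omega> \<partial>M)"
    unfolding eq by (simp add: int' Bochner_Integration.integral_sum)
  also have "\<dots> = (\<Sum>i\<in>I. \<Sum>j\<in>I. if i = j then \<integral>\<omega>. (norm (v i \<omega>))\<^sup>2 \<partial>M else 0)"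
    by (intro sum.cong) (auto simp: orth power2_norm_eq_inner)
  also have "\<dots> = (\<Sum>i\<in>I. \<integral>\<omega>. (norm (v i \<omega>))\<^sup>2 \<partial>M)"
    using \<open>finite I\<close> by simp
  finally show "(\<integral>\<omega>. (norm (\<Sum>i\<in>I. v i \<omega>))\<^sup>2 \<partial>M) = (\<Sum>i\<in>I. \<integral>\<omega>. (norm (v i \<omega>))\<^sup>2 \<partial>M)" .
qed

section \<open>The quantization noise of one step\<close>

text \<open>The information available at the start of step \<open>k\<close>, which determines the iterates up to \<open>k\<close> and
  hence all vectors that are quantized in this step.\<close>

abbreviation past :: "nat \<Rightarrow> 'w measure \<Rightarrow> 's measure \<Rightarrow> (nat \<Rightarrow> nat \<Rightarrow> 'w \<Rightarrow> 's) \<Rightarrow> nat \<Rightarrow> 'w measure" where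
  "past m M N \<xi> k \<equiv> seed_algebra M N (\<lambda>(k, i). \<xi> k i) ({..<k} \<times> {1..m})"

text \<open>The delayed iterates that enter a step are all earlier than the new one, hence the strong
  induction.\<close>

lemma iterates_measurable_past:
  assumes Q[measurable]: "(\<lambda>(s, v). Q s v) \<in> borel_measurable (N \<Otimes>\<^sub>M borel)"
    and grad: "\<And>i. i \<in> {1..m} \<Longrightarrow> grad (f i) \<in> borel_measurable borel"
    and \<xi>: "\<And>k i. i \<in> {1..m} \<Longrightarrow> \<xi> k i \<in> measurable M N"
    and iter: "delayed_quantized_gradient_iterates m f Q delay \<gamma> x0 M \<xi> x"
  shows "x k \<in> borel_measurable (past m M N \<xi> k)"
proof (induction k rule: less_induct)
  case (less k)
  show ?case
  proof (cases k)
    case 0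
    have "x 0 \<in> borel_measurable (past m M N \<xi> 0) \<longleftrightarrow> (\<lambda>_. x0) \<in> borel_measurable (past m M N \<xi> 0)"
      using iter by (intro measurable_cong) (simp add: delayed_quantized_gradient_iterates_def)
    then show ?thesis by (simp add: 0)
  next
    case (Suc j)
    let ?H = "past m M N \<xi> k"
    have old[measurable]: "x j' \<in> borel_measurable ?H" if "j' \<le> j" for j'
      by (rule measurable_seed_algebra_mono[OF _ _ less.IH[of j']]) (use \<xi> that Suc in auto)
    have [measurable]: "\<xi> j i \<in> measurable ?H N" if "i \<in> {1..m}" for i
      using measurable_seed_algebra[of "{..<k} \<times> {1..m}" "\<lambda>(k, i). \<xi> k i" M N "(j, i)"] \<xi> that Suc
      by auto
    have "(\<lambda>\<omega>. Q (\<xi> j i \<omega>) (grad (f i) (x (j - delay j i) \<omega>))) \<in> borel_measurable ?H" if i: "i \<in> {1..m}" for i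
    proof -
      note [measurable] = grad[OF i]
      have [measurable]: "x (j - delay j i) \<in> borel_measurable ?H"
        by (rule old) simp
      show ?thesis using i by measurable
    qed
    then have "(\<lambda>\<omega>. x j \<omega> - \<gamma> *\<^sub>R (\<Sum>i=1..m. Q (\<xi> j i \<omega>) (grad (f i) (x (j - delay j i) \<omega>)))) \<in> borel_measurable ?H"
      using old[of j] by (intro borel_measurable_diff borel_measurable_scaleR borel_measurable_sum) auto
    moreover have "x k \<in> borel_measurable ?H \<longleftrightarrow>
        (\<lambda>\<omega>. x j \<omega> - \<gamma> *\<^sub>R (\<Sum>i=1..m. Q (\<xi> j i \<omega>) (grad (f i) (x (j - delay j i) \<omega>)))) \<in> borel_measurable ?H"
      using iter Suc by (intro measurable_cong) (simp add: delayed_quantized_gradient_iterates_def)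
    ultimately show ?thesis by simp
  qed
qed

text \<open>The noise of component \<open>i\<close> is orthogonal to everything determined by the remaining seeds of the
  steps up to \<open>k\<close>. These determine both \<open>W\<close> and the noise of the other components of the
  same step.\<close>

lemma aggregated_noise:
  fixes v :: "nat \<Rightarrow> 'w \<Rightarrow> real ^ 'd" and W :: "'w \<Rightarrow> real ^ 'd"
  assumes "prob_space M" and quantizer: "unbiased_random_quantizer N Q \<alpha>"
    and error: "\<And>v. (\<integral>s. (norm (Q s v - v))\<^sup>2 \<partial>N) \<le> \<beta> * (norm v)\<^sup>2" and \<beta>: "0 \<le> \<beta>"
    and fresh: "fresh_seeds m M N \<xi>"
    and v: "\<And>i. i \<in> {1..m} \<Longrightarrow> v i \<in> borel_measurable (past m M N \<xi> k)"
    and C: "\<And>i \<omega>. i \<in> {1..m} \<Longrightarrow> norm (v i \<omega>) \<le> C"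
    and W: "W \<in> borel_measurable (past m M N \<xi> k)" and B: "\<And>\<omega>. norm (W \<omega>) \<le> B"
  defines "n \<equiv> \<lambda>\<omega>. \<Sum>i=1..m. Q (\<xi> k i \<omega>) (v i \<omega>) - v i \<omega>"
  shows "integrable M (\<lambda>\<omega>. (norm (n \<omega>))\<^sup>2)"
    and "(\<integral>\<omega>. (norm (n \<omega>))\<^sup>2 \<partial>M) \<le> real m * (\<beta> * C\<^sup>2)"
    and "integrable M (\<lambda>\<omega>. W \<omega> \<bullet> n \<omega>)"
    and "(\<integral>\<omega>. W \<omega> \<bullet> n \<omega> \<partial>M) = 0"
proof -
  interpret prob_space M by fact
  let ?Z = "\<lambda>(k, i). \<xi> k i"
  \<comment> \<open>All seeds drawn up to step \<open>k\<close> apart from the one of component \<open>i\<close>.\<close>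
  define J where "J i = {..k} \<times> {1..m} - {(k, i)}" for i
  define A where "A i = seed_algebra M N ?Z (J i)" for i
  define e where "e i \<omega> = Q (\<xi> k i \<omega>) (v i \<omega>) - v i \<omega>" for i \<omega>
  have Z: "?Z p \<in> measurable M N" if "p \<in> UNIV \<times> {1..m}" for p
    using fresh that by (auto simp: fresh_seeds_def indep_vars_def)
  have past_A: "h \<in> borel_measurable (A i)"
    if "h \<in> borel_measurable (past m M N \<xi> k)" for h :: "'w \<Rightarrow> real ^ 'd" and i
    unfolding A_def by (rule measurable_seed_algebra_mono[OF _ _ that]) (use Z in \<open>auto simp: J_def\<close>)
  have seed: "quantized_seed M N (A i) (\<xi> k i) Q \<alpha> \<beta>" if i: "i \<in> {1..m}" for i
  proof -
    have "fresh_seed M N (A i) (?Z (k, i))"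
      unfolding A_def by (rule fresh_seed_seed_algebra[OF \<open>prob_space M\<close>, where I = "UNIV \<times> {1..m}"])
        (use fresh i in \<open>auto simp: fresh_seeds_def J_def\<close>)
    then show ?thesis
      using quantizer error by (intro quantized_seed.intro quantized_seed_axioms.intro) auto
  qed
  have Q: "(\<lambda>(s, v). Q s v) \<in> borel_measurable (N \<Otimes>\<^sub>M borel)"
    using quantizer by (simp add: unbiased_random_quantizer_def)
  have to_M: "h \<in> borel_measurable M"
    if "h \<in> borel_measurable (A i)" "i \<in> {1..m}" for h :: "'w \<Rightarrow> real ^ 'd" and i
    by (rule measurable_compose[OF fresh_seed.sub[OF quantized_seed.axioms(1)[OF seed[OF that(2)]]] that(1)])
  have e_A: "e j \<in> borel_measurable (A i)" if "i \<in> {1..m}" "j \<in> {1..m}" "i \<noteq> j" for i j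
  proof -
    have [measurable]: "\<xi> k j \<in> measurable (A i) N"
      using measurable_seed_algebra[of "J i" ?Z M N "(k, j)"] Z that by (auto simp: A_def J_def)
    note [measurable] = Q past_A[OF v[OF that(2)]]
    show ?thesis unfolding e_def by measurable
  qed
  have e_M: "e i \<in> borel_measurable M" if "i \<in> {1..m}" for i
  proof -
    have [measurable]: "\<xi> k i \<in> measurable M N"
      using Z[of "(k, i)"] that by auto
    note [measurable] = Q to_M[OF past_A[OF v[OF that]] that]
    show ?thesis unfolding e_def by measurable
  qed
  have e_sq: "integrable M (\<lambda>\<omega>. (norm (e i \<omega>))\<^sup>2)" "(\<integral>\<omega>. (norm (e i \<omega>))\<^sup>2 \<partial>M) \<le> \<beta> * C\<^sup>2"
    if i: "i \<in> {1..m}" for i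
    using quantized_seed.noise_second_moment[OF seed[OF i] past_A[OF v[OF i]] C[OF i] \<beta>]
    by (auto simp: e_def)
  have e_orth: "integrable M (\<lambda>\<omega>. h \<omega> \<bullet> e i \<omega>)" "(\<integral>\<omega>. h \<omega> \<bullet> e i \<omega> \<partial>M) = 0"
    if i: "i \<in> {1..m}" and h: "h \<in> borel_measurable (A i)" "integrable M (\<lambda>\<omega>. (norm (h \<omega>))\<^sup>2)" for i h
  proof -
    show int: "integrable M (\<lambda>\<omega>. h \<omega> \<bullet> e i \<omega>)"
      by (intro integrable_inner_if_square_integrable to_M[OF h(1) i] e_M e_sq h i)
    show "(\<integral>\<omega>. h \<omega> \<bullet> e i \<omega> \<partial>M) = 0"
      using quantized_seed.noise_orthogonal[OF seed[OF i] past_A[OF v[OF i]] h(1)] int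
      by (simp add: e_def)
  qed
  have orth: "(\<integral>\<omega>. e i \<omega> \<bullet> e j \<omega> \<partial>M) = 0" if "i \<in> {1..m}" "j \<in> {1..m}" "i \<noteq> j" for i j
    using that by (intro e_orth e_A e_sq) auto
  have n: "n = (\<lambda>\<omega>. \<Sum>i=1..m. e i \<omega>)"
    by (simp add: n_def e_def)
  show "integrable M (\<lambda>\<omega>. (norm (n \<omega>))\<^sup>2)"
    unfolding n by (rule expected_square_sum_orthogonal) (use e_M e_sq orth in auto)
  have "(\<integral>\<omega>. (norm (n \<omega>))\<^sup>2 \<partial>M) = (\<Sum>i=1..m. \<integral>\<omega>. (norm (e i \<omega>))\<^sup>2 \<partial>M)"
    unfolding n by (rule expected_square_sum_orthogonal) (use e_M e_sq orth in auto)
  also have "\<dots> \<le> (\<Sum>i=1..m. \<beta> * C\<^sup>2)"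
    using e_sq by (intro sum_mono) auto
  finally show "(\<integral>\<omega>. (norm (n \<omega>))\<^sup>2 \<partial>M) \<le> real m * (\<beta> * C\<^sup>2)"
    by simp
  have W_sq: "integrable M (\<lambda>\<omega>. (norm (W \<omega>))\<^sup>2)" if i: "i \<in> {1..m}" for i
  proof (rule integrable_const_bound)
    note [measurable] = to_M[OF past_A[OF W] i]
    show "(\<lambda>\<omega>. (norm (W \<omega>))\<^sup>2) \<in> borel_measurable M" by measurable
    show "AE \<omega> in M. norm ((norm (W \<omega>))\<^sup>2) \<le> B\<^sup>2"
      using power_mono[OF B norm_ge_zero, of _ 2] by simp
  qed
  have W_e: "integrable M (\<lambda>\<omega>. W \<omega> \<bullet> e i \<omega>)" "(\<integral>\<omega>. W \<omega> \<bullet> e i \<omega> \<partial>M) = 0" if "i \<in> {1..m}" for i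
    using e_orth[OF that past_A[OF W] W_sq[OF that]] by auto
  show "integrable M (\<lambda>\<omega>. W \<omega> \<bullet> n \<omega>)" "(\<integral>\<omega>. W \<omega> \<bullet> n \<omega> \<partial>M) = 0"
    unfolding n inner_sum_right using W_e by (auto simp: Bochner_Integration.integral_sum)
qed

section \<open>The convergence theorem\<close>

text \<open>The bound on \<open>u\<close> is the positive root of \<open>2 \<tau> (\<tau> + 1) t\<^sup>2 + t = 1\<close>, and \<open>\<tau>\<^sup>2 \<le> 2 \<tau> (\<tau> + 1)\<close>.\<close>

lemma step_size_quadratic:
  fixes u :: real
  assumes "0 \<le> u" and "u \<le> 2 / (1 + sqrt (1 + 8 * real \<tau> * (real \<tau> + 1)))"
  shows "(real \<tau>)\<^sup>2 * u\<^sup>2 + u \<le> 1"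
proof -
  define s where "s = sqrt (1 + 8 * real \<tau> * (real \<tau> + 1))"
  define t where "t = 2 / (1 + s)"
  have s: "0 \<le> s" "s\<^sup>2 = 1 + 8 * real \<tau> * (real \<tau> + 1)"
    by (auto simp: s_def)
  then have root: "2 * (real \<tau> * (real \<tau> + 1)) * t\<^sup>2 + t = 1"
  proof -
    have "2 * (real \<tau> * (real \<tau> + 1)) * t\<^sup>2 = (s\<^sup>2 - 1) / 4 * t\<^sup>2"
      by (simp add: s(2) algebra_simps)
    also have "\<dots> = (s - 1) / (s + 1)"
      using s(1) by (simp add: t_def divide_simps power2_eq_square) (simp add: algebra_simps)
    also have "\<dots> = 1 - t"
      using s(1) by (simp add: t_def field_simps)
    finally show ?thesis by simp
  qed
  have u: "u \<le> t"
    using assms by (simp add: t_def s_def)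
  have "(real \<tau>)\<^sup>2 * u\<^sup>2 \<le> (2 * (real \<tau> * (real \<tau> + 1))) * t\<^sup>2"
    using u assms(1) by (intro mult_mono power_mono) (auto simp: power2_eq_square algebra_simps)
  then show ?thesis
    using root u by linarith
qed

theorem theorem6p3:
  fixes m :: nat
    and f :: "nat \<Rightarrow> real ^ 'd \<Rightarrow> real"
    and F :: "real ^ 'd \<Rightarrow> real"
    and l :: "real \<Rightarrow> real \<Rightarrow> real"
    and a :: "nat \<Rightarrow> real ^ 'd"
    and b :: "nat \<Rightarrow> real"
    and L C \<Delta> Lbar \<sigma> \<alpha> \<beta> \<gamma> e Fstar :: real
    and N :: "'s measure"
    and Q :: "'s \<Rightarrow> real ^ 'd \<Rightarrow> real ^ 'd"
    and M :: "'w measure"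
    and \<xi> :: "nat \<Rightarrow> nat \<Rightarrow> 'w \<Rightarrow> 's"
    and delay :: "nat \<Rightarrow> nat \<Rightarrow> nat"
    and \<tau> :: nat
    and x0 :: "real ^ 'd"
    and x :: "nat \<Rightarrow> 'w \<Rightarrow> real ^ 'd"
    and K :: nat
  assumes "m \<ge> 1" and "L > 0"
    and F: "F = (\<lambda>z. \<Sum>i=1..m. f i z)"
    and convex_smooth: "\<And>i. i \<in> {1..m} \<Longrightarrow> convex_smooth L (f i)"
    and loss: "\<And>i z. i \<in> {1..m} \<Longrightarrow> f i z = l (a i \<bullet> z) (b i)"
    and supp_grad: "\<And>i z. i \<in> {1..m} \<Longrightarrow> supp (grad (f i) z) = supp (a i)"
    and grad_bounded: "\<And>i z. i \<in> {1..m} \<Longrightarrow> norm (grad (f i) z) \<le> C"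
    and Fstar_attained: "\<exists>z. F z = Fstar"
    and Fstar_minimal: "\<And>z. Fstar \<le> F z"
    and \<Delta>: "\<Delta> = min (Delta_ave m a) (Delta_max m a)"
    and Lbar: "Lbar = L * sqrt (real m * (1 + \<Delta>))"
    and \<sigma>: "\<sigma> = min (sqrt (real m * (1 + Delta_ave m a))) (1 + Delta_max m a)"
    and quantizer: "unbiased_random_quantizer N Q \<alpha>"
    and "0 < \<beta>" and "\<beta> \<le> \<alpha> - 1"
    and quantizer_error: "\<And>v. (\<integral>s. (norm (Q s v - v))\<^sup>2 \<partial>N) \<le> \<beta> * (norm v)\<^sup>2"
    and "prob_space M"
    and fresh: "fresh_seeds m M N \<xi>"
    and delay_bounded: "\<And>k i. i \<in> {1..m} \<Longrightarrow> delay k i \<le> \<tau>"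
    and "0 < \<gamma>"
    and step_size: "\<gamma> < 1 / (1 + sqrt (1 + 8 * real \<tau> * (real \<tau> + 1))) * (2 / Lbar)"
    and iterates: "delayed_quantized_gradient_iterates m f Q delay \<gamma> x0 M \<xi> x"
    and e: "e = 2 * \<beta> * \<sigma> * real m * C\<^sup>2"
  shows "Min ((\<lambda>k. \<integral>\<omega>. (norm (grad F (x k \<omega>)))\<^sup>2 \<partial>M) ` {0..K})
           \<le> 2 / \<gamma> * (1 / real (K + 1)) * (F x0 - Fstar) + e"
proof -
  interpret prob_space M by fact
  define g where "g i = grad (f i)" for i
  define D where "D = grad F"
  have F_deriv: "GDERIV F z :> (\<Sum>i=1..m. g i z)" for z
    unfolding F g_def using convex_smooth
    by (intro GDERIV_sum GDERIV_grad) (auto simp: convex_smooth_def)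
  then have D: "D z = (\<Sum>i=1..m. g i z)" for z
    unfolding D_def by (rule grad_eqI)
  have \<Delta>_eq: "\<Delta> = Delta_ave m a"
    using Delta_ave_le_Delta_max[OF \<open>m \<ge> 1\<close>, of a] by (simp add: \<Delta> min_absorb1)
  have Lbar_pos: "0 < Lbar"
    using \<open>m \<ge> 1\<close> \<open>L > 0\<close> Delta_ave_nonneg[of m a] by (simp add: Lbar \<Delta>_eq)
  have g_lip: "norm (g i y - g i z) \<le> L * norm (y - z)" if "i \<in> {1..m}" for i y z
    unfolding g_def using convex_smooth_grad_lipschitz[OF convex_smooth[OF that] \<open>L > 0\<close>] .
  have drift: "norm (D y - (\<Sum>i=1..m. g i (z i))) \<le> Lbar * R"
    if close: "\<And>i. i \<in> {1..m} \<Longrightarrow> norm (y - z i) \<le> R" and "0 \<le> R" for y z R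
  proof -
    have "norm (\<Sum>i=1..m. g i y - g i (z i)) \<le> sqrt (real m * (1 + Delta_ave m a)) * (L * R)"
    proof (rule norm_sum_sparse_le[OF \<open>m \<ge> 1\<close>])
      \<comment> \<open>Both gradients are supported on the support of \<open>a i\<close>, hence so is their difference.\<close>
      show "supp (g i y - g i (z i)) \<subseteq> supp (a i)" if "i \<in> {1..m}" for i
        using supp_diff_subset[of "g i y" "g i (z i)"] supp_grad[OF that] by (simp add: g_def)
      show "norm (g i y - g i (z i)) \<le> L * R" if "i \<in> {1..m}" for i
      proof -
        have "norm (g i y - g i (z i)) \<le> L * norm (y - z i)"
          by (rule g_lip[OF that])
        also have "\<dots> \<le> L * R"
          using close[OF that] \<open>L > 0\<close> by simp
        finally show ?thesis .
      qed
    qed (use \<open>L > 0\<close> \<open>0 \<le> R\<close> in auto)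
    then show ?thesis
      by (simp add: D Lbar \<Delta>_eq sum_subtractf mult_ac)
  qed
  have D_lip: "norm (D z - D y) \<le> Lbar * norm (z - y)" for y z
    using drift[of z "\<lambda>_. y" "norm (z - y)"] by (simp add: D)
  have descent: "F z \<le> F y + D y \<bullet> (z - y) + Lbar / 2 * (norm (z - y))\<^sup>2" for y z
    by (rule lipschitz_gradient_descent_bound[OF _ D_lip]) (use F_deriv in \<open>simp add: D\<close>)
  have "\<gamma> * Lbar < 1 / (1 + sqrt (1 + 8 * real \<tau> * (real \<tau> + 1))) * (2 / Lbar) * Lbar"
    using step_size Lbar_pos by (rule mult_strict_right_mono)
  also have "\<dots> = 2 / (1 + sqrt (1 + 8 * real \<tau> * (real \<tau> + 1)))"
    using Lbar_pos by simp
  finally have step: "(real \<tau>)\<^sup>2 * (\<gamma> * Lbar)\<^sup>2 + \<gamma> * Lbar \<le> 1"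
    using Lbar_pos \<open>0 < \<gamma>\<close> by (intro step_size_quadratic) auto

  define v where "v k i \<omega> = g i (x (k - delay k i) \<omega>)" for k i \<omega>
  define h where "h k \<omega> = (\<Sum>i=1..m. v k i \<omega>)" for k \<omega>
  define n where "n k \<omega> = (\<Sum>i=1..m. Q (\<xi> k i \<omega>) (v k i \<omega>) - v k i \<omega>)" for k \<omega>
  have pathwise: "\<gamma> / 2 * (\<Sum>k<K+1. (norm (D (x k \<omega>)))\<^sup>2)
      \<le> F x0 - Fstar + (\<Sum>k<K+1. \<gamma> * ((h k \<omega> - D (x k \<omega>)) \<bullet> n k \<omega>) + \<gamma> / 2 * (norm (n k \<omega>))\<^sup>2)"
    if \<omega>: "\<omega> \<in> space M" for \<omega>
  proof -
    have "\<gamma> / 2 * (\<Sum>k<K+1. (norm (D (x k \<omega>)))\<^sup>2)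
      \<le> F (x 0 \<omega>) - F (x (K+1) \<omega>)
        + (\<Sum>k<K+1. \<gamma> * ((h k \<omega> - D (x k \<omega>)) \<bullet> n k \<omega>) + \<gamma> / 2 * (norm (n k \<omega>))\<^sup>2)"
    proof (rule perturbed_delayed_descent[where I = "{1..m}" and g = g and delay = delay,
            OF descent drift \<open>0 < \<gamma>\<close> _ step])
      show "x (Suc k) \<omega> = x k \<omega> - \<gamma> *\<^sub>R (h k \<omega> + n k \<omega>)" for k
        using iterates \<omega>
        by (simp add: delayed_quantized_gradient_iterates_def h_def n_def v_def g_def sum_subtractf)
    qed (use Lbar_pos delay_bounded in \<open>auto simp: h_def v_def\<close>)
    moreover have "x 0 \<omega> = x0"
      using iterates \<omega> by (simp add: delayed_quantized_gradient_iterates_def)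
    ultimately show ?thesis
      using Fstar_minimal[of "x (K+1) \<omega>"] by simp
  qed

  \<comment> \<open>What remains is to take expectations; \<open>h k - D (x k)\<close> is determined by the past, and the uniform
    gradient bound and the error bound of the quantizer make everything square integrable.\<close>
  have Q_meas: "(\<lambda>(s, v). Q s v) \<in> borel_measurable (N \<Otimes>\<^sub>M borel)"
    using quantizer by (simp add: unbiased_random_quantizer_def)
  have \<xi>_meas: "\<xi> k i \<in> measurable M N" if "i \<in> {1..m}" for k i
    using fresh that unfolding fresh_seeds_def indep_vars_def by fastforce
  have g_meas: "g i \<in> borel_measurable borel" if "i \<in> {1..m}" for i
  proof (rule borel_measurable_continuous_onI)
    have "L-lipschitz_on UNIV (g i)"
      using g_lip[OF that] \<open>L > 0\<close> by (intro lipschitz_onI) (auto simp: dist_norm)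
    then show "continuous_on UNIV (g i)"
      by (rule lipschitz_on_continuous_on)
  qed
  have D_meas: "D \<in> borel_measurable borel"
    unfolding D[abs_def] using g_meas by (rule borel_measurable_sum)
  have x_past: "x k \<in> borel_measurable (past m M N \<xi> k)" for k
    by (rule iterates_measurable_past[OF Q_meas _ _ iterates]) (use g_meas \<xi>_meas in \<open>auto simp: g_def\<close>)
  have v_past: "v k i \<in> borel_measurable (past m M N \<xi> k)" if "i \<in> {1..m}" for k i
  proof -
    have "x (k - delay k i) \<in> borel_measurable (past m M N \<xi> k)"
      by (rule measurable_seed_algebra_mono[OF _ _ x_past]) (use \<xi>_meas in auto)
    from measurable_compose[OF this g_meas[OF that]] show ?thesis
      by (simp add: v_def[abs_def])
  qed
  have v_bound: "norm (v k i \<omega>) \<le> C" if "i \<in> {1..m}" for k i \<omega>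
    using grad_bounded[OF that] by (simp add: v_def g_def)
  have D_bound: "norm (D z) \<le> real m * C" for z
    unfolding D using sum_norm_le[of "{1..m}" "\<lambda>i. g i z" "\<lambda>_. C"] grad_bounded by (simp add: g_def)
  have h_bound: "norm (h k \<omega>) \<le> real m * C" for k \<omega>
    unfolding h_def using sum_norm_le[of "{1..m}" "\<lambda>i. v k i \<omega>" "\<lambda>_. C"] v_bound by simp
  have W_past: "(\<lambda>\<omega>. h k \<omega> - D (x k \<omega>)) \<in> borel_measurable (past m M N \<xi> k)" for k
    unfolding h_def
    by (intro borel_measurable_diff borel_measurable_sum v_past measurable_compose[OF x_past D_meas])
  have W_bound: "norm (h k \<omega> - D (x k \<omega>)) \<le> real m * C + real m * C" for k \<omega>
    using norm_triangle_ineq4[of "h k \<omega>" "D (x k \<omega>)"] h_bound[of k \<omega>] D_bound[of "x k \<omega>"] by linarith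
  have noise: "integrable M (\<lambda>\<omega>. (norm (n k \<omega>))\<^sup>2)"
      "(\<integral>\<omega>. (norm (n k \<omega>))\<^sup>2 \<partial>M) \<le> real m * (\<beta> * C\<^sup>2)"
      "integrable M (\<lambda>\<omega>. (h k \<omega> - D (x k \<omega>)) \<bullet> n k \<omega>)"
      "(\<integral>\<omega>. (h k \<omega> - D (x k \<omega>)) \<bullet> n k \<omega> \<partial>M) = 0" for k
    using aggregated_noise[where k = k, OF \<open>prob_space M\<close> quantizer quantizer_error _ fresh
        v_past v_bound W_past W_bound] \<open>0 < \<beta>\<close> by (auto simp: n_def)
  have D_int: "integrable M (\<lambda>\<omega>. (norm (D (x k \<omega>)))\<^sup>2)" for k
  proof (rule integrable_const_bound)
    have "(\<lambda>\<omega>. \<omega>) \<in> measurable M (past m M N \<xi> k)"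
      unfolding seed_algebra_def using \<xi>_meas
      by (intro measurable_vimage_algebra2 measurable_restrict) auto
    from measurable_compose[OF this x_past] have "x k \<in> borel_measurable M"
      by simp
    note [measurable] = this D_meas
    show "(\<lambda>\<omega>. (norm (D (x k \<omega>)))\<^sup>2) \<in> borel_measurable M"
      by measurable
    show "AE \<omega> in M. norm ((norm (D (x k \<omega>)))\<^sup>2) \<le> (real m * C)\<^sup>2"
      using power_mono[OF D_bound norm_ge_zero, of _ 2] by simp
  qed

  define Y where "Y k \<omega> = \<gamma> * ((h k \<omega> - D (x k \<omega>)) \<bullet> n k \<omega>) + \<gamma> / 2 * (norm (n k \<omega>))\<^sup>2" for k \<omega>
  have Y: "integrable M (Y k)" "(\<integral>\<omega>. Y k \<omega> \<partial>M) = \<gamma> / 2 * (\<integral>\<omega>. (norm (n k \<omega>))\<^sup>2 \<partial>M)" for k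
    unfolding Y_def using noise[of k] by auto
  define E where "E k = (\<integral>\<omega>. (norm (D (x k \<omega>)))\<^sup>2 \<partial>M)" for k
  have "\<gamma> / 2 * (\<Sum>k<K+1. E k) = (\<integral>\<omega>. \<gamma> / 2 * (\<Sum>k<K+1. (norm (D (x k \<omega>)))\<^sup>2) \<partial>M)"
    unfolding E_def using D_int by (simp add: Bochner_Integration.integral_sum)
  also have "\<dots> \<le> (\<integral>\<omega>. F x0 - Fstar + (\<Sum>k<K+1. Y k \<omega>) \<partial>M)"
    using D_int Y pathwise unfolding Y_def[symmetric]
    by (intro integral_mono Bochner_Integration.integrable_add Bochner_Integration.integrable_sum
        integrable_mult_right) auto
  also have "\<dots> = F x0 - Fstar + (\<Sum>k<K+1. \<gamma> / 2 * (\<integral>\<omega>. (norm (n k \<omega>))\<^sup>2 \<partial>M))"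
    using Y(1) by (simp add: Y(2) prob_space Bochner_Integration.integral_sum
        Bochner_Integration.integrable_sum del: sum.lessThan_Suc)
  also have "\<dots> \<le> F x0 - Fstar + (\<Sum>k<K+1. \<gamma> / 2 * (real m * (\<beta> * C\<^sup>2)))"
    using noise \<open>0 < \<gamma>\<close> by (intro add_left_mono sum_mono mult_left_mono) auto
  finally have sum_E: "\<gamma> / 2 * (\<Sum>k<K+1. E k) \<le> F x0 - Fstar + real (K + 1) * (\<gamma> / 2 * (real m * (\<beta> * C\<^sup>2)))"
    by simp
  have Min_le: "Min (E ` {0..K}) \<le> E k" if "k < K + 1" for k
    using that by (intro Min_le) auto
  have "real (K + 1) * Min (E ` {0..K}) \<le> (\<Sum>k<K+1. E k)"
    using sum_mono[of "{..<K+1}" "\<lambda>_. Min (E ` {0..K})" E] Min_le by simp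
  then have "\<gamma> / 2 * (real (K + 1) * Min (E ` {0..K})) \<le> \<gamma> / 2 * (\<Sum>k<K+1. E k)"
    using \<open>0 < \<gamma>\<close> by (intro mult_left_mono) auto
  with sum_E have "\<gamma> / 2 * (real (K + 1) * Min (E ` {0..K}))
      \<le> F x0 - Fstar + real (K + 1) * (\<gamma> / 2 * (real m * (\<beta> * C\<^sup>2)))"
    by linarith
  moreover have "(Min (E ` {0..K}) - real m * (\<beta> * C\<^sup>2)) * (\<gamma> / 2 * real (K + 1))
      = \<gamma> / 2 * (real (K + 1) * Min (E ` {0..K})) - real (K + 1) * (\<gamma> / 2 * (real m * (\<beta> * C\<^sup>2)))"
    by (simp only: left_diff_distrib right_diff_distrib mult_ac)
  ultimately have "(Min (E ` {0..K}) - real m * (\<beta> * C\<^sup>2)) * (\<gamma> / 2 * real (K + 1)) \<le> F x0 - Fstar"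
    by linarith
  then have "Min (E ` {0..K}) - real m * (\<beta> * C\<^sup>2) \<le> (F x0 - Fstar) / (\<gamma> / 2 * real (K + 1))"
    using \<open>0 < \<gamma>\<close> by (subst pos_le_divide_eq) auto
  also have "\<dots> = 2 / \<gamma> * (1 / real (K + 1)) * (F x0 - Fstar)"
    by simp
  finally have "Min (E ` {0..K}) \<le> 2 / \<gamma> * (1 / real (K + 1)) * (F x0 - Fstar) + real m * (\<beta> * C\<^sup>2)"
    by simp
  also have "real m * (\<beta> * C\<^sup>2) \<le> e"
  proof -
    have "1 \<le> sqrt (real m * (1 + Delta_ave m a))"
    proof -
      have "1 * 1 \<le> real m * (1 + Delta_ave m a)"
        using \<open>m \<ge> 1\<close> Delta_ave_nonneg[of m a] by (intro mult_mono) auto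
      then show ?thesis by simp
    qed
    moreover have "0 \<le> Delta_max m a"
      using Delta_ave_nonneg[of m a] Delta_ave_le_Delta_max[OF \<open>m \<ge> 1\<close>, of a] by linarith
    ultimately have "1 \<le> \<sigma>"
      by (simp add: \<sigma>)
    then have "1 \<le> 2 * \<sigma>"
      by linarith
    then have "1 * (real m * (\<beta> * C\<^sup>2)) \<le> 2 * \<sigma> * (real m * (\<beta> * C\<^sup>2))"
      using \<open>0 < \<beta>\<close> by (intro mult_right_mono) auto
    then show ?thesis by (simp add: e mult_ac)
  qed
  finally show ?thesis
    by (simp add: E_def D_def)
qed

end
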